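(* Let $(A,D)$ be an augmented ring. There is a one-to-one correspondence between the set of division rings $B$ that are subrings of $A$ such that $A_B$ is a finite-dimensional right vector space, and the set of Galois subrings of $\operatorname{End}A$. The correspondence is given by $B\mapsto\operatorname{End}A_B$, with inverse correspondence $\mathcal R\mapsto\operatorname{End}{}_{\mathcal R}A$.
   Context: Rings are unital and subrings share the identity. An augmented ring $(A,D)$ is a ring $A$ together with a ring homomorphism $A\to D$ where $D$ is a division ring. $\operatorname{End}A$ denotes the ring $\operatorname{End}A_{\mathbb Z}$ of additive endomorphisms of $A$ under composition, and $\lambda(A)\subseteq\operatorname{End}A$ the subring of left multiplications $\lambda_a(x)=ax$. A Galois subring of $\operatorname{End}A$ is a subring $\mathcal R\subseteq\operatorname{End}A$ that contains $\lambda(A)$, is finitely generated as a left $\lambda(A)$-module, and is such that the left $\mathcal R$-module ${}_{\mathcal R}A$ (by evaluation) is simple. $\operatorname{End}A_B$ is the ring of right $B$-linear endomorphisms of $A$. Since $\mathcal R\supseteq\lambda(A)$, every element of $\operatorname{End}{}_{\mathcal R}A$ is a right multiplication $\rho_x:a\mapsto ax$; $\operatorname{End}{}_{\mathcal R}A$ is identified (up to passing to the opposite ring) with the subring $\{x\in A:\rho_x\in\operatorname{End}{}_{\mathcal R}A\}$ of $A$. *)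

theory Defs
  imports "HOL-Algebra.Subrings"
begin

(* HOL-Algebra's field is commutative.  The zero ring is excluded, since there Units R = {\<zero>}. *)
locale skew_field = ring R for R (structure) +
  assumes skew_field_Units: "Units R = carrier R - {\<zero>}"

locale augmented_ring = ring_hom_ring A D h + D: skew_field D
  for A (structure) and D (structure) and h

(* Maps are extensional, so that equality in End_ring A is equality of maps on carrier A. *)
definition End_ring :: "('a, 'm) ring_scheme \<Rightarrow> ('a \<Rightarrow> 'a) ring" where
  "End_ring A =
    \<lparr>carrier = hom (add_monoid A) (add_monoid A) \<inter> extensional (carrier A),
     mult = compose (carrier A),
     one = (\<lambda>x\<in>carrier A. x),
     zero = (\<lambda>x\<in>carrier A. \<zero>\<^bsub>A\<^esub>),
     add = (\<lambda>f g. \<lambda>x\<in>carrier A. f x \<oplus>\<^bsub>A\<^esub> g x)\<rparr>"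

definition left_mult :: "('a, 'm) ring_scheme \<Rightarrow> 'a \<Rightarrow> 'a \<Rightarrow> 'a" where
  "left_mult A a = (\<lambda>x\<in>carrier A. a \<otimes>\<^bsub>A\<^esub> x)"

definition right_mult :: "('a, 'm) ring_scheme \<Rightarrow> 'a \<Rightarrow> 'a \<Rightarrow> 'a" where
  "right_mult A x = (\<lambda>a\<in>carrier A. a \<otimes>\<^bsub>A\<^esub> x)"

definition left_mults :: "('a, 'm) ring_scheme \<Rightarrow> ('a \<Rightarrow> 'a) set" where
  "left_mults A = left_mult A ` carrier A"

lemma End_ringI:
  assumes "\<And>x. x \<in> carrier A \<Longrightarrow> f x \<in> carrier A"
    and "\<And>x y. x \<in> carrier A \<Longrightarrow> y \<in> carrier A \<Longrightarrow> f (x \<oplus>\<^bsub>A\<^esub> y) = f x \<oplus>\<^bsub>A\<^esub> f y"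
    and "f \<in> extensional (carrier A)"
  shows "f \<in> carrier (End_ring A)"
  using assms by (auto simp: End_ring_def hom_def)

lemma End_ringD:
  assumes "f \<in> carrier (End_ring A)"
  shows "x \<in> carrier A \<Longrightarrow> f x \<in> carrier A"
    and "x \<in> carrier A \<Longrightarrow> y \<in> carrier A \<Longrightarrow> f (x \<oplus>\<^bsub>A\<^esub> y) = f x \<oplus>\<^bsub>A\<^esub> f y"
    and "f \<in> extensional (carrier A)"
  using assms by (auto simp: End_ring_def hom_def)

lemma (in ring) End_ring_is_ring: "ring (End_ring R)"
proof (rule ringI)
  show "abelian_group (End_ring R)"
  proof (rule abelian_groupI)
    fix f assume f: "f \<in> carrier (End_ring R)"
    let ?g = "\<lambda>x\<in>carrier R. \<ominus> (f x)"
    have "?g \<in> carrier (End_ring R)"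
      by (rule End_ringI) (auto simp: End_ringD[OF f] minus_add)
    moreover have "?g \<oplus>\<^bsub>End_ring R\<^esub> f = \<zero>\<^bsub>End_ring R\<^esub>"
      by (auto simp: End_ring_def l_neg End_ringD(1)[OF f])
    ultimately show "\<exists>g\<in>carrier (End_ring R). g \<oplus>\<^bsub>End_ring R\<^esub> f = \<zero>\<^bsub>End_ring R\<^esub>"
      by blast
    show "\<zero>\<^bsub>End_ring R\<^esub> \<oplus>\<^bsub>End_ring R\<^esub> f = f"
      by (rule extensionalityI[where A = "carrier R"]) (auto simp: End_ring_def End_ringD[OF f])
  next
    show "\<zero>\<^bsub>End_ring R\<^esub> \<in> carrier (End_ring R)"
      by (rule End_ringI) (auto simp: End_ring_def)
  next
    fix f g assume "f \<in> carrier (End_ring R)" and "g \<in> carrier (End_ring R)"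
    note fg = this[THEN End_ringD(1)] this[THEN End_ringD(2)]
    show "f \<oplus>\<^bsub>End_ring R\<^esub> g \<in> carrier (End_ring R)"
      by (rule End_ringI) (auto simp: End_ring_def fg a_ac)
    show "f \<oplus>\<^bsub>End_ring R\<^esub> g = g \<oplus>\<^bsub>End_ring R\<^esub> f"
      by (rule extensionalityI[where A = "carrier R"]) (auto simp: End_ring_def fg a_comm)
    fix k assume "k \<in> carrier (End_ring R)"
    note k = End_ringD(1)[OF this]
    show "(f \<oplus>\<^bsub>End_ring R\<^esub> g) \<oplus>\<^bsub>End_ring R\<^esub> k = f \<oplus>\<^bsub>End_ring R\<^esub> (g \<oplus>\<^bsub>End_ring R\<^esub> k)"
      by (rule extensionalityI[where A = "carrier R"]) (auto simp: End_ring_def fg k a_assoc)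
  qed
  show "monoid (End_ring R)"
  proof (rule monoidI)
    fix f assume "f \<in> carrier (End_ring R)"
    note f = End_ringD[OF this]
    show "\<one>\<^bsub>End_ring R\<^esub> \<otimes>\<^bsub>End_ring R\<^esub> f = f"
      by (rule extensionalityI[where A = "carrier R"]) (auto simp: End_ring_def compose_def f)
    show "f \<otimes>\<^bsub>End_ring R\<^esub> \<one>\<^bsub>End_ring R\<^esub> = f"
      by (rule extensionalityI[where A = "carrier R"]) (auto simp: End_ring_def compose_def f)
    fix g assume "g \<in> carrier (End_ring R)"
    note g = End_ringD[OF this]
    show "f \<otimes>\<^bsub>End_ring R\<^esub> g \<in> carrier (End_ring R)"
      by (rule End_ringI) (auto simp: End_ring_def compose_def f g)
    fix k assume "k \<in> carrier (End_ring R)"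
    note k = End_ringD[OF this]
    show "(f \<otimes>\<^bsub>End_ring R\<^esub> g) \<otimes>\<^bsub>End_ring R\<^esub> k = f \<otimes>\<^bsub>End_ring R\<^esub> (g \<otimes>\<^bsub>End_ring R\<^esub> k)"
      by (rule extensionalityI[where A = "carrier R"]) (auto simp: End_ring_def compose_def k)
  next
    show "\<one>\<^bsub>End_ring R\<^esub> \<in> carrier (End_ring R)"
      by (rule End_ringI) (auto simp: End_ring_def)
  qed
next
  fix f g k
  assume f: "f \<in> carrier (End_ring R)" and g: "g \<in> carrier (End_ring R)"
    and k: "k \<in> carrier (End_ring R)"
  show "(f \<oplus>\<^bsub>End_ring R\<^esub> g) \<otimes>\<^bsub>End_ring R\<^esub> k =
      f \<otimes>\<^bsub>End_ring R\<^esub> k \<oplus>\<^bsub>End_ring R\<^esub> g \<otimes>\<^bsub>End_ring R\<^esub> k"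
    by (rule extensionalityI[where A = "carrier R"])
      (auto simp: End_ring_def compose_def End_ringD[OF k])
  show "k \<otimes>\<^bsub>End_ring R\<^esub> (f \<oplus>\<^bsub>End_ring R\<^esub> g) =
      k \<otimes>\<^bsub>End_ring R\<^esub> f \<oplus>\<^bsub>End_ring R\<^esub> k \<otimes>\<^bsub>End_ring R\<^esub> g"
    by (rule extensionalityI[where A = "carrier R"])
      (auto simp: End_ring_def compose_def End_ringD[OF f] End_ringD[OF g] End_ringD[OF k])
qed

(* The left L-submodule of E generated by a finite set S, where L is a subring of E. *)
definition left_span :: "('e, 'm) ring_scheme \<Rightarrow> 'e set \<Rightarrow> 'e set \<Rightarrow> 'e set" where
  "left_span E L S = {\<Oplus>\<^bsub>E\<^esub>s\<in>S. c s \<otimes>\<^bsub>E\<^esub> s | c. c \<in> S \<rightarrow> L}"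

definition fin_gen_left :: "('e, 'm) ring_scheme \<Rightarrow> 'e set \<Rightarrow> 'e set \<Rightarrow> bool" where
  "fin_gen_left E L M \<longleftrightarrow> (\<exists>S. finite S \<and> S \<subseteq> M \<and> M = left_span E L S)"

definition simple_by_evaluation :: "('a, 'm) ring_scheme \<Rightarrow> ('a \<Rightarrow> 'a) set \<Rightarrow> bool" where
  "simple_by_evaluation A \<R> \<longleftrightarrow>
     carrier A \<noteq> {\<zero>\<^bsub>A\<^esub>} \<and>
     (\<forall>N. additive_subgroup N A \<and> (\<forall>f\<in>\<R>. \<forall>x\<in>N. f x \<in> N) \<longrightarrow> N = {\<zero>\<^bsub>A\<^esub>} \<or> N = carrier A)"

definition galois_subring :: "('a, 'm) ring_scheme \<Rightarrow> ('a \<Rightarrow> 'a) set \<Rightarrow> bool" where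
  "galois_subring A \<R> \<longleftrightarrow>
     subring \<R> (End_ring A) \<and> left_mults A \<subseteq> \<R> \<and>
     fin_gen_left (End_ring A) (left_mults A) \<R> \<and> simple_by_evaluation A \<R>"

(* The right B-vector space A has a finite basis S: every element of A has unique coordinates. *)
definition fin_dim_right :: "('a, 'm) ring_scheme \<Rightarrow> 'a set \<Rightarrow> bool" where
  "fin_dim_right A B \<longleftrightarrow>
     (\<exists>S. finite S \<and> S \<subseteq> carrier A \<and>
       (\<forall>x\<in>carrier A. \<exists>!c. c \<in> S \<rightarrow>\<^sub>E B \<and> x = (\<Oplus>\<^bsub>A\<^esub>s\<in>S. s \<otimes>\<^bsub>A\<^esub> c s)))"

definition fin_division_subring :: "('a, 'm) ring_scheme \<Rightarrow> 'a set \<Rightarrow> bool" where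
  "fin_division_subring A B \<longleftrightarrow>
     subring B A \<and> skew_field (A\<lparr>carrier := B\<rparr>) \<and> fin_dim_right A B"

definition End_right :: "('a, 'm) ring_scheme \<Rightarrow> 'a set \<Rightarrow> ('a \<Rightarrow> 'a) set" where
  "End_right A B =
     {f \<in> carrier (End_ring A). \<forall>a\<in>carrier A. \<forall>b\<in>B. f (a \<otimes>\<^bsub>A\<^esub> b) = f a \<otimes>\<^bsub>A\<^esub> b}"

definition End_left :: "('a, 'm) ring_scheme \<Rightarrow> ('a \<Rightarrow> 'a) set \<Rightarrow> ('a \<Rightarrow> 'a) set" where
  "End_left A \<R> =
     {g \<in> carrier (End_ring A). \<forall>f\<in>\<R>. \<forall>a\<in>carrier A. g (f a) = f (g a)}"

(* End_left A \<R> viewed as a subset of A; the three lemmas below justify the identification. *)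
definition End_left_elems :: "('a, 'm) ring_scheme \<Rightarrow> ('a \<Rightarrow> 'a) set \<Rightarrow> 'a set" where
  "End_left_elems A \<R> = {x \<in> carrier A. right_mult A x \<in> End_left A \<R>}"

lemma (in ring) End_left_eq_right_mults:
  assumes "left_mults R \<subseteq> \<R>"
  shows "End_left R \<R> = right_mult R ` End_left_elems R \<R>"
proof
  show "End_left R \<R> \<subseteq> right_mult R ` End_left_elems R \<R>"
  proof
    fix g assume g: "g \<in> End_left R \<R>"
    then have gE: "g \<in> carrier (End_ring R)" by (simp add: End_left_def)
    have 1: "g \<one> \<in> carrier R" using End_ringD(1)[OF gE] by simp
    have ga: "g a = a \<otimes> g \<one>" if a: "a \<in> carrier R" for a
    proof -
      have "left_mult R a \<in> \<R>" using assms a by (auto simp: left_mults_def)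
      then have "g (left_mult R a \<one>) = left_mult R a (g \<one>)"
        using g by (auto simp: End_left_def)
      then show ?thesis using a 1 by (simp add: left_mult_def)
    qed
    have eq: "right_mult R (g \<one>) = g"
    proof (rule extensionalityI[OF _ End_ringD(3)[OF gE]])
      show "right_mult R (g \<one>) \<in> extensional (carrier R)" by (simp add: right_mult_def)
      show "right_mult R (g \<one>) a = g a" if "a \<in> carrier R" for a
        unfolding right_mult_def restrict_apply' [OF that] by (rule ga[OF that, symmetric])
    qed
    have "g \<one> \<in> End_left_elems R \<R>"
      using g 1 unfolding End_left_elems_def mem_Collect_eq eq by blast
    then show "g \<in> right_mult R ` End_left_elems R \<R>"
      by (rule image_eqI[rotated]) (rule eq[symmetric])
  qed
qed (auto simp: End_left_elems_def)

lemma (in ring) inj_on_right_mult: "inj_on (right_mult R) (carrier R)"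
proof (rule inj_onI)
  fix x y assume "x \<in> carrier R" "y \<in> carrier R" "right_mult R x = right_mult R y"
  then show "x = y" by (auto simp: right_mult_def dest!: fun_cong[where x = \<one>])
qed

lemma (in ring) right_mult_anti_hom:
  assumes "x \<in> carrier R" "y \<in> carrier R"
  shows "right_mult R (x \<oplus> y) = right_mult R x \<oplus>\<^bsub>End_ring R\<^esub> right_mult R y"
    and "right_mult R (x \<otimes> y) = right_mult R y \<otimes>\<^bsub>End_ring R\<^esub> right_mult R x"
    and "right_mult R \<one> = \<one>\<^bsub>End_ring R\<^esub>"
  using assms by (auto simp: right_mult_def End_ring_def compose_def r_distr m_assoc)

end

theory Submission
  imports Defs "HOL-Algebra.UnivPoly" "Jordan_Normal_Form.Missing_Ring"
begin

text \<open>
  Both directions rest on one notion: a dual system for a set \<open>\<R>\<close> of additive endomorphisms of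
  \<open>A\<close>, that is, a finite subset \<open>X\<close> of \<open>A\<close> with maps \<open>e x \<in> \<R>\<close> such that \<open>e x y\<close> is the
  Kronecker delta for \<open>x, y \<in> X\<close>.

  If \<open>A\<close> has a finite right basis over a division subring \<open>B\<close>, the basis and its coordinate
  functionals form a dual system for \<open>End_right A B\<close> whose functionals take values in \<open>B\<close>. Every
  \<open>B\<close>-linear \<open>f\<close> is the sum of the maps \<open>y \<mapsto> f x \<otimes> e x y\<close>, so the functionals generate
  \<open>End_right A B\<close> as a left \<open>A\<close>-module (\<open>End_right_expansion\<close>). A nonzero \<open>y\<close> has a nonzero
  coordinate \<open>b\<close>, and \<open>a = (a \<otimes> inv b) \<otimes> b\<close> shows that \<open>y\<close> generates \<open>A\<close>. If right
  multiplication by \<open>x\<close> commutes with all of \<open>End_right A B\<close>, then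
  \<open>e z \<one> \<otimes> x = e z x\<close> lies in \<open>B\<close> for each \<open>z\<close>, hence so does \<open>x\<close>.

  Conversely let \<open>\<R>\<close> be a Galois subring. By Schur's argument its centralizer \<open>B\<close> is a division
  ring. If \<open>\<R>\<close> has \<open>n\<close> generators over the left multiplications, then expressing each \<open>e x\<close> by the
  generators and evaluating at \<open>X\<close> writes the identity matrix of size \<open>card X\<close> as a product that
  factors through \<open>n\<close>. Its image in the division ring \<open>D\<close> forces \<open>card X \<le> n\<close>
  (\<open>dual_system_card_le\<close>); this is where the augmentation enters. So there is a dual system of
  greatest size. It cannot be extended, which by simplicity of \<open>A\<close> means that a member of
  \<open>\<R>\<close> vanishing on \<open>X\<close> is zero, so that equality in \<open>\<R>\<close> can be tested on \<open>X\<close>. Two such tests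
  replace the density theorem (\<open>right_coordinates_if_maximal\<close>): the maps
  \<open>y \<mapsto> f (a \<otimes> e x y)\<close> and \<open>y \<mapsto> f a \<otimes> e x y\<close> agree on \<open>X\<close>, so all values of \<open>e x\<close> are in \<open>B\<close>;
  and the sum of the maps \<open>y \<mapsto> x \<otimes> e x y\<close> agrees on \<open>X\<close> with the identity, so \<open>X\<close> is a right
  \<open>B\<close>-basis with coordinates \<open>e\<close>. The expansion of \<open>B\<close>-linear maps then gives
  \<open>End_right A B = \<R>\<close>.
\<close>

section \<open>Linear systems over a skew field\<close>

text \<open>
  Gaussian elimination, by induction on the set of equations: an equation with a nonzero
  coefficient is solved for one unknown, and substituting removes one equation and one unknown.
  Coefficients stand on the left of the unknowns, so row operations multiply on the left.
\<close>

lemma (in skew_field) underdetermined_system_nontrivial_solution: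
  assumes "finite I" and "finite J" and "card I < card J"
    and "\<And>i j. i \<in> I \<Longrightarrow> j \<in> J \<Longrightarrow> F i j \<in> carrier R"
  shows "\<exists>v\<in>J \<rightarrow> carrier R. (\<exists>j\<in>J. v j \<noteq> \<zero>) \<and> (\<forall>i\<in>I. (\<Oplus>j\<in>J. F i j \<otimes> v j) = \<zero>)"
  using assms
proof (induction I arbitrary: J F rule: finite_induct)
  case empty
  then obtain p where "p \<in> J" by fastforce
  moreover have "\<one> \<noteq> \<zero>" using skew_field_Units Units_one_closed by auto
  ultimately show ?case by (intro bexI[of _ "\<lambda>_. \<one>"]) auto
next
  case (insert i I)
  show ?case
  proof (cases "\<forall>j\<in>J. F i j = \<zero>")
    case True
    have "card I < card J" using insert.prems insert.hyps by auto
    with insert.IH[of J F] insert.prems obtain v where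
      v: "v \<in> J \<rightarrow> carrier R" "\<exists>j\<in>J. v j \<noteq> \<zero>" "\<forall>k\<in>I. (\<Oplus>j\<in>J. F k j \<otimes> v j) = \<zero>" by auto
    have "(\<Oplus>j\<in>J. F i j \<otimes> v j) = (\<Oplus>j\<in>J. \<zero>)"
      using True v by (intro finsum_cong') (auto simp: Pi_def)
    then show ?thesis using v by auto
  next
    case False
    then obtain p where p: "p \<in> J" "F i p \<noteq> \<zero>" by auto
    let ?J = "J - {p}"
    have J: "J = insert p ?J" "finite ?J" "p \<notin> ?J" using p insert.prems by auto
    have Fc: "F k j \<in> carrier R" if "k \<in> insert i I" "j \<in> J" for k j
      using insert.prems that by blast
    have "F i p \<in> Units R" using skew_field_Units p Fc by auto
    then obtain u where u: "u \<in> carrier R" "F i p \<otimes> u = \<one>" by (auto simp: Units_def)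
    \<comment> \<open>The coefficients of the other rows after unknown \<open>p\<close> is eliminated by means of row \<open>i\<close>.\<close>
    define G where "G k j = F k j \<oplus> \<ominus> (F k p \<otimes> u) \<otimes> F i j" for k j
    have card: "card I < card ?J"
      using insert.prems insert.hyps p by (simp add: card_Diff_singleton)
    have "G k j \<in> carrier R" if "k \<in> I" "j \<in> ?J" for k j
      using p u Fc that by (simp add: G_def)
    then have "\<exists>v\<in>?J \<rightarrow> carrier R. (\<exists>j\<in>?J. v j \<noteq> \<zero>) \<and> (\<forall>k\<in>I. (\<Oplus>j\<in>?J. G k j \<otimes> v j) = \<zero>)"
      by (intro insert.IH J(2) card)
    then obtain v where
      v: "v \<in> ?J \<rightarrow> carrier R" "\<exists>j\<in>?J. v j \<noteq> \<zero>" "\<forall>k\<in>I. (\<Oplus>j\<in>?J. G k j \<otimes> v j) = \<zero>"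
      by (elim bexE conjE) (rule that, blast+)
    have vc: "v j \<in> carrier R" if "j \<in> ?J" for j using v that by auto
    define T where "T k = (\<Oplus>j\<in>?J. F k j \<otimes> v j)" for k
    have Tc: "T k \<in> carrier R" if "k \<in> insert i I" for k
      unfolding T_def using that Fc vc by (intro finsum_closed) auto
    \<comment> \<open>The value at \<open>p\<close> is the one that makes row \<open>i\<close> vanish.\<close>
    define w where "w = v(p := \<ominus> (u \<otimes> T i))"
    have w: "w \<in> J \<rightarrow> carrier R" using vc Tc u by (auto simp: w_def)
    have row: "(\<Oplus>j\<in>J. F k j \<otimes> w j) = F k p \<otimes> \<ominus> (u \<otimes> T i) \<oplus> T k" if k: "k \<in> insert i I" for k
    proof -
      have "(\<Oplus>j\<in>J. F k j \<otimes> w j) = F k p \<otimes> w p \<oplus> (\<Oplus>j\<in>?J. F k j \<otimes> w j)"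
        by (subst J(1), rule finsum_insert) (use J w p Fc[OF k] in auto)
      also have "(\<Oplus>j\<in>?J. F k j \<otimes> w j) = T k"
        unfolding T_def by (intro finsum_cong') (use vc Fc[OF k] in \<open>auto simp: w_def\<close>)
      finally show ?thesis by (simp add: w_def)
    qed
    have "(\<Oplus>j\<in>J. F k j \<otimes> w j) = \<zero>" if "k \<in> insert i I" for k
    proof (cases "k = i")
      case True
      have "F i p \<otimes> (u \<otimes> T i) = T i"
        using m_assoc[of "F i p" u "T i"] u Fc p Tc by simp
      then show ?thesis using row[of i] True u Fc p Tc by (simp add: r_minus l_neg)
    next
      case False
      with that have k: "k \<in> I" by simp
      let ?c = "\<ominus> (F k p \<otimes> u)"
      have c: "?c \<in> carrier R" using Fc p u k by auto
      have "\<zero> = (\<Oplus>j\<in>?J. G k j \<otimes> v j)" using v k by simp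
      also have "\<dots> = (\<Oplus>j\<in>?J. F k j \<otimes> v j \<oplus> ?c \<otimes> (F i j \<otimes> v j))"
        by (intro finsum_cong') (use c vc Fc k in \<open>auto simp: G_def l_distr m_assoc\<close>)
      also have "\<dots> = T k \<oplus> (\<Oplus>j\<in>?J. ?c \<otimes> (F i j \<otimes> v j))"
        unfolding T_def by (rule finsum_addf) (use c vc Fc k in auto)
      also have "(\<Oplus>j\<in>?J. ?c \<otimes> (F i j \<otimes> v j)) = ?c \<otimes> T i"
        unfolding T_def by (rule finsum_rdistr[symmetric]) (use J c vc Fc k in auto)
      also have "T k \<oplus> ?c \<otimes> T i = F k p \<otimes> \<ominus> (u \<otimes> T i) \<oplus> T k"
        using c u Fc p Tc k by (simp add: l_minus r_minus m_assoc a_comm)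
      finally show ?thesis using row[of k] k by simp
    qed
    moreover have "\<exists>j\<in>J. w j \<noteq> \<zero>" using v(2) by (auto simp: w_def)
    ultimately show ?thesis using w by blast
  qed
qed

text \<open>
  The rank condition that a ring inherits from any division ring to which it maps: over \<open>D\<close>, more
  columns than rows give a nonzero \<open>v\<close> with \<open>Q v = 0\<close>, but then \<open>v = P (Q v) = 0\<close>.
\<close>

lemma (in augmented_ring) card_le_of_matrix_left_inverse:
  assumes "finite I" and "finite J"
    and P: "\<And>k i. k \<in> J \<Longrightarrow> i \<in> I \<Longrightarrow> P k i \<in> carrier A"
    and Q: "\<And>i j. i \<in> I \<Longrightarrow> j \<in> J \<Longrightarrow> Q i j \<in> carrier A"
    and PQ: "\<And>k j. k \<in> J \<Longrightarrow> j \<in> J \<Longrightarrow> (\<Oplus>\<^bsub>A\<^esub>i\<in>I. P k i \<otimes>\<^bsub>A\<^esub> Q i j) = (if k = j then \<one>\<^bsub>A\<^esub> else \<zero>\<^bsub>A\<^esub>)"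
  shows "card J \<le> card I"
proof (rule ccontr)
  assume "\<not> card J \<le> card I"
  then have "card I < card J" by simp
  moreover have "\<And>i j. i \<in> I \<Longrightarrow> j \<in> J \<Longrightarrow> h (Q i j) \<in> carrier D" using Q by simp
  ultimately obtain v where v: "v \<in> J \<rightarrow> carrier D" "\<exists>j\<in>J. v j \<noteq> \<zero>\<^bsub>D\<^esub>"
    and sol: "\<And>i. i \<in> I \<Longrightarrow> (\<Oplus>\<^bsub>D\<^esub>j\<in>J. h (Q i j) \<otimes>\<^bsub>D\<^esub> v j) = \<zero>\<^bsub>D\<^esub>"
    using D.underdetermined_system_nontrivial_solution[of I J "\<lambda>i j. h (Q i j)"] assms(1,2) by blast
  have vc: "v j \<in> carrier D" if "j \<in> J" for j using v that by auto
  have "v k = \<zero>\<^bsub>D\<^esub>" if k: "k \<in> J" for k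
  proof -
    have PQc: "h (P k i) \<in> carrier D" "h (Q i j) \<in> carrier D" if "i \<in> I" "j \<in> J" for i j
      using P[OF k] Q that by auto
    have hPQ: "(\<Oplus>\<^bsub>D\<^esub>i\<in>I. h (P k i) \<otimes>\<^bsub>D\<^esub> h (Q i j)) = (if k = j then \<one>\<^bsub>D\<^esub> else \<zero>\<^bsub>D\<^esub>)"
      if j: "j \<in> J" for j
    proof -
      have "(\<Oplus>\<^bsub>D\<^esub>i\<in>I. h (P k i) \<otimes>\<^bsub>D\<^esub> h (Q i j)) = (\<Oplus>\<^bsub>D\<^esub>i\<in>I. h (P k i \<otimes>\<^bsub>A\<^esub> Q i j))"
        using P k Q j by (intro S.finsum_cong') auto
      also have "\<dots> = h (\<Oplus>\<^bsub>A\<^esub>i\<in>I. P k i \<otimes>\<^bsub>A\<^esub> Q i j)"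
        by (subst hom_finsum) (use P k Q j in \<open>auto simp: o_def\<close>)
      also have "\<dots> = (if k = j then \<one>\<^bsub>D\<^esub> else \<zero>\<^bsub>D\<^esub>)" using PQ[OF k j] by simp
      finally show ?thesis .
    qed
    have "v k = (\<Oplus>\<^bsub>D\<^esub>j\<in>J. if k = j then v j else \<zero>\<^bsub>D\<^esub>)"
      using S.finsum_singleton[OF k assms(2) v(1)] by simp
    also have "\<dots> = (\<Oplus>\<^bsub>D\<^esub>j\<in>J. (\<Oplus>\<^bsub>D\<^esub>i\<in>I. h (P k i) \<otimes>\<^bsub>D\<^esub> h (Q i j)) \<otimes>\<^bsub>D\<^esub> v j)"
      by (intro S.finsum_cong') (use vc hPQ in auto)
    also have "\<dots> = (\<Oplus>\<^bsub>D\<^esub>j\<in>J. \<Oplus>\<^bsub>D\<^esub>i\<in>I. h (P k i) \<otimes>\<^bsub>D\<^esub> (h (Q i j) \<otimes>\<^bsub>D\<^esub> v j))"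
    proof (intro S.finsum_cong' refl)
      fix j assume j: "j \<in> J"
      have "(\<Oplus>\<^bsub>D\<^esub>i\<in>I. h (P k i) \<otimes>\<^bsub>D\<^esub> h (Q i j)) \<otimes>\<^bsub>D\<^esub> v j
          = (\<Oplus>\<^bsub>D\<^esub>i\<in>I. h (P k i) \<otimes>\<^bsub>D\<^esub> h (Q i j) \<otimes>\<^bsub>D\<^esub> v j)"
        by (rule S.finsum_ldistr) (use assms(1) vc PQc j in auto)
      also have "\<dots> = (\<Oplus>\<^bsub>D\<^esub>i\<in>I. h (P k i) \<otimes>\<^bsub>D\<^esub> (h (Q i j) \<otimes>\<^bsub>D\<^esub> v j))"
        by (intro S.finsum_cong') (use vc PQc j in \<open>auto simp: S.m_assoc\<close>)
      finally show "(\<Oplus>\<^bsub>D\<^esub>i\<in>I. h (P k i) \<otimes>\<^bsub>D\<^esub> h (Q i j)) \<otimes>\<^bsub>D\<^esub> v j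
          = (\<Oplus>\<^bsub>D\<^esub>i\<in>I. h (P k i) \<otimes>\<^bsub>D\<^esub> (h (Q i j) \<otimes>\<^bsub>D\<^esub> v j))" .
    qed (use vc PQc in \<open>auto intro!: S.finsum_closed\<close>)
    also have "\<dots> = (\<Oplus>\<^bsub>D\<^esub>i\<in>I. \<Oplus>\<^bsub>D\<^esub>j\<in>J. h (P k i) \<otimes>\<^bsub>D\<^esub> (h (Q i j) \<otimes>\<^bsub>D\<^esub> v j))"
      by (rule S.finsum_finsum_swap) (use assms(1,2) vc PQc in auto)
    also have "\<dots> = (\<Oplus>\<^bsub>D\<^esub>i\<in>I. \<zero>\<^bsub>D\<^esub>)"
    proof (intro S.finsum_cong' refl)
      fix i assume i: "i \<in> I"
      have "(\<Oplus>\<^bsub>D\<^esub>j\<in>J. h (P k i) \<otimes>\<^bsub>D\<^esub> (h (Q i j) \<otimes>\<^bsub>D\<^esub> v j))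
          = h (P k i) \<otimes>\<^bsub>D\<^esub> (\<Oplus>\<^bsub>D\<^esub>j\<in>J. h (Q i j) \<otimes>\<^bsub>D\<^esub> v j)"
        by (rule S.finsum_rdistr[symmetric]) (use assms(2) vc P k Q i in auto)
      then show "(\<Oplus>\<^bsub>D\<^esub>j\<in>J. h (P k i) \<otimes>\<^bsub>D\<^esub> (h (Q i j) \<otimes>\<^bsub>D\<^esub> v j)) = \<zero>\<^bsub>D\<^esub>"
        using sol[OF i] P[OF k i] by simp
    qed auto
    finally show ?thesis by simp
  qed
  with v(2) show False by blast
qed

section \<open>Arithmetic in the endomorphism ring\<close>

context ring
begin

lemma End_ring_apply:
  assumes "x \<in> carrier R"
  shows "(f \<oplus>\<^bsub>End_ring R\<^esub> g) x = f x \<oplus> g x"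
    and "(f \<otimes>\<^bsub>End_ring R\<^esub> g) x = f (g x)"
    and "\<zero>\<^bsub>End_ring R\<^esub> x = \<zero>"
    and "\<one>\<^bsub>End_ring R\<^esub> x = x"
    and "left_mult R a x = a \<otimes> x"
  using assms by (simp_all add: End_ring_def compose_def left_mult_def)

lemma End_ring_eqI:
  assumes "f \<in> carrier (End_ring R)" and "g \<in> carrier (End_ring R)"
    and "\<And>x. x \<in> carrier R \<Longrightarrow> f x = g x"
  shows "f = g"
  using assms by (meson End_ringD(3) extensionalityI)

lemma End_ring_zero: "f \<in> carrier (End_ring R) \<Longrightarrow> f \<zero> = \<zero>"
  by (metis End_ringD(1,2) add.l_cancel_one' zero_closed)

lemma End_ring_a_inv_apply:
  assumes f: "f \<in> carrier (End_ring R)" and x: "x \<in> carrier R"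
  shows "(\<ominus>\<^bsub>End_ring R\<^esub> f) x = \<ominus> (f x)"
proof -
  interpret E: ring "End_ring R" by (rule End_ring_is_ring)
  have "(\<ominus>\<^bsub>End_ring R\<^esub> f) x \<oplus> f x = (\<ominus>\<^bsub>End_ring R\<^esub> f \<oplus>\<^bsub>End_ring R\<^esub> f) x"
    using x by (simp add: End_ring_apply)
  also have "\<dots> = \<zero>" using f x by (simp add: E.l_neg End_ring_apply)
  finally show ?thesis
    using f x by (metis End_ringD(1) E.a_inv_closed minus_equality)
qed

lemma left_mult_closed: "a \<in> carrier R \<Longrightarrow> left_mult R a \<in> carrier (End_ring R)"
  by (rule End_ringI) (auto simp: left_mult_def r_distr)

lemma End_ring_finsum_apply:
  assumes "F \<in> X \<rightarrow> carrier (End_ring R)" and y: "y \<in> carrier R"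
  shows "(\<Oplus>\<^bsub>End_ring R\<^esub>x\<in>X. F x) y = (\<Oplus>x\<in>X. F x y)"
  using assms(1)
proof (induction X rule: infinite_finite_induct)
  interpret E: ring "End_ring R" by (rule End_ring_is_ring)
  case (insert x X)
  then show ?case using y by (simp add: End_ring_apply End_ringD(1) Pi_iff)
next
  interpret E: ring "End_ring R" by (rule End_ring_is_ring)
  case (infinite X)
  then show ?case using y by (simp add: End_ring_apply)
next
  interpret E: ring "End_ring R" by (rule End_ring_is_ring)
  case empty
  then show ?case using y by (simp add: End_ring_apply)
qed

lemma End_ring_finsum:
  assumes f: "f \<in> carrier (End_ring R)" and "F \<in> X \<rightarrow> carrier R"
  shows "f (\<Oplus>x\<in>X. F x) = (\<Oplus>x\<in>X. f (F x))"
  using assms(2)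
proof (induction X rule: infinite_finite_induct)
  case (insert x X)
  then show ?case by (simp add: End_ringD[OF f] Pi_iff)
qed (simp_all add: End_ring_zero[OF f])

lemma subring_finsum_closed:
  assumes "subring H R" and "F \<in> X \<rightarrow> H"
  shows "(\<Oplus>x\<in>X. F x) \<in> H"
  using assms(2)
proof (induction X rule: infinite_finite_induct)
  case (insert x X)
  then have "F \<in> X \<rightarrow> carrier R" "F x \<in> carrier R"
    using subringE(1)[OF assms(1)] by auto
  with insert show ?case by (simp add: subringE[OF assms(1)])
qed (simp_all add: subringE(2)[OF assms(1)])

lemma End_right_apply:
  "f \<in> End_right R B \<Longrightarrow> a \<in> carrier R \<Longrightarrow> b \<in> B \<Longrightarrow> f (a \<otimes> b) = f a \<otimes> b"
  by (simp add: End_right_def)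

lemma subring_End_right:
  assumes "B \<subseteq> carrier R"
  shows "subring (End_right R B) (End_ring R)"
proof -
  interpret E: ring "End_ring R" by (rule End_ring_is_ring)
  have B: "b \<in> carrier R" if "b \<in> B" for b using assms that by auto
  show ?thesis
    by (rule E.subringI)
      (auto simp: End_right_def End_ring_apply B End_ring_a_inv_apply l_minus l_distr End_ringD(1))
qed

lemma left_mults_subset_End_right:
  assumes "B \<subseteq> carrier R"
  shows "left_mults R \<subseteq> End_right R B"
  using assms by (auto simp: left_mults_def End_right_def left_mult_closed End_ring_apply m_assoc subset_eq)

end

section \<open>Dual systems and coordinates\<close>

definition dual_system ::
    "('a, 'm) ring_scheme \<Rightarrow> ('a \<Rightarrow> 'a) set \<Rightarrow> 'a set \<Rightarrow> ('a \<Rightarrow> 'a \<Rightarrow> 'a) \<Rightarrow> bool" where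
  "dual_system A \<R> X e \<longleftrightarrow> finite X \<and> X \<subseteq> carrier A \<and> e \<in> X \<rightarrow> \<R> \<and>
     (\<forall>x\<in>X. \<forall>y\<in>X. e x y = (if x = y then \<one>\<^bsub>A\<^esub> else \<zero>\<^bsub>A\<^esub>))"

text \<open>
  Here \<open>X\<close> is a right \<open>B\<close>-basis of \<open>A\<close> and \<open>e x\<close> is the coordinate functional at \<open>x\<close>.
\<close>

definition right_coordinates ::
    "('a, 'm) ring_scheme \<Rightarrow> 'a set \<Rightarrow> 'a set \<Rightarrow> ('a \<Rightarrow> 'a \<Rightarrow> 'a) \<Rightarrow> bool" where
  "right_coordinates A B X e \<longleftrightarrow> dual_system A (End_right A B) X e \<and>
     (\<forall>x\<in>X. \<forall>y\<in>carrier A. e x y \<in> B) \<and>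
     (\<forall>y\<in>carrier A. y = (\<Oplus>\<^bsub>A\<^esub>x\<in>X. x \<otimes>\<^bsub>A\<^esub> e x y))"

context ring
begin

lemma right_coordinates_unique:
  assumes B: "B \<subseteq> carrier R" and co: "right_coordinates R B X e"
    and c: "c \<in> X \<rightarrow> B" and x: "x \<in> X"
  shows "e x (\<Oplus>z\<in>X. z \<otimes> c z) = c x"
proof -
  have X: "finite X" "X \<subseteq> carrier R" and ex: "e x \<in> End_right R B"
    and d: "\<And>z. z \<in> X \<Longrightarrow> e x z = (if x = z then \<one> else \<zero>)"
    using co x by (auto simp: right_coordinates_def dual_system_def)
  have cc: "c \<in> X \<rightarrow> carrier R" using B c by auto
  have exE: "e x \<in> carrier (End_ring R)" using ex by (simp add: End_right_def)
  have "e x (\<Oplus>z\<in>X. z \<otimes> c z) = (\<Oplus>z\<in>X. e x (z \<otimes> c z))"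
    by (rule End_ring_finsum[OF exE]) (use X cc in auto)
  also have "\<dots> = (\<Oplus>z\<in>X. if x = z then c z else \<zero>)"
  proof (intro finsum_cong' refl)
    fix z assume z: "z \<in> X"
    have "e x (z \<otimes> c z) = e x z \<otimes> c z"
      using End_right_apply[OF ex] X c z by blast
    then show "e x (z \<otimes> c z) = (if x = z then c z else \<zero>)"
      using z d cc by (auto simp: Pi_iff)
  qed (use cc in auto)
  also have "\<dots> = c x" by (rule finsum_singleton[OF x X(1) cc])
  finally show ?thesis .
qed

lemma fin_dim_right_if_right_coordinates:
  assumes B: "B \<subseteq> carrier R" and co: "right_coordinates R B X e"
  shows "fin_dim_right R B"
  unfolding fin_dim_right_def
proof (intro exI conjI ballI)
  show "finite X" "X \<subseteq> carrier R" using co by (auto simp: right_coordinates_def dual_system_def)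
  fix y assume y: "y \<in> carrier R"
  show "\<exists>!c. c \<in> X \<rightarrow>\<^sub>E B \<and> y = (\<Oplus>x\<in>X. x \<otimes> c x)"
  proof (rule ex1I[of _ "\<lambda>x\<in>X. e x y"], rule conjI)
    show "(\<lambda>x\<in>X. e x y) \<in> X \<rightarrow>\<^sub>E B" using co y by (auto simp: right_coordinates_def)
    have "e x y \<in> carrier R" if "x \<in> X" for x
      using B co that y by (auto simp: right_coordinates_def)
    then have "(\<Oplus>x\<in>X. x \<otimes> (\<lambda>x\<in>X. e x y) x) = (\<Oplus>x\<in>X. x \<otimes> e x y)"
      using \<open>X \<subseteq> carrier R\<close> by (intro finsum_cong') auto
    then show "y = (\<Oplus>x\<in>X. x \<otimes> (\<lambda>x\<in>X. e x y) x)"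
      using co y by (simp add: right_coordinates_def)
  next
    fix c assume c: "c \<in> X \<rightarrow>\<^sub>E B \<and> y = (\<Oplus>x\<in>X. x \<otimes> c x)"
    then have "e x y = c x" if "x \<in> X" for x
      using right_coordinates_unique[OF B co _ that, of c] by (auto simp: PiE_def)
    with c show "c = (\<lambda>x\<in>X. e x y)" by (intro ext) (auto simp: PiE_def extensional_def)
  qed
qed

text \<open>
  The functionals are read off from the unique coordinates; uniqueness makes them additive,
  \<open>B\<close>-linear and dual to the basis.
\<close>

lemma right_coordinates_if_fin_dim_right:
  assumes B: "subring B R" and "fin_dim_right R B"
  obtains X e where "right_coordinates R B X e"
proof -
  obtain X where X: "finite X" "X \<subseteq> carrier R"
    and "\<forall>y\<in>carrier R. \<exists>!c. c \<in> X \<rightarrow>\<^sub>E B \<and> y = (\<Oplus>x\<in>X. x \<otimes> c x)"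
    using assms(2) unfolding fin_dim_right_def by (elim exE conjE) (rule that)
  note ex1 = bspec[OF this(3)]
  have Bc: "b \<in> carrier R" if "b \<in> B" for b using subringE(1)[OF B] that by auto
  define c where "c y = (THE c. c \<in> X \<rightarrow>\<^sub>E B \<and> y = (\<Oplus>x\<in>X. x \<otimes> c x))" for y
  have c: "c y \<in> X \<rightarrow>\<^sub>E B" "y = (\<Oplus>x\<in>X. x \<otimes> c y x)" if "y \<in> carrier R" for y
    using theI'[OF ex1[OF that]] unfolding c_def by (rule conjunct1, rule conjunct2)
  have cB: "c y x \<in> B" if "y \<in> carrier R" "x \<in> X" for y x using c(1)[OF that(1)] that(2) by auto
  have uniq: "d x = c y x"
    if y: "y \<in> carrier R" and d: "d \<in> X \<rightarrow> B" "y = (\<Oplus>x\<in>X. x \<otimes> d x)" and x: "x \<in> X" for y d x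
  proof -
    have "(\<Oplus>x\<in>X. x \<otimes> restrict d X x) = (\<Oplus>x\<in>X. x \<otimes> d x)"
      using X d Bc by (intro finsum_cong') (auto simp: Pi_iff)
    with d have "restrict d X \<in> X \<rightarrow>\<^sub>E B \<and> y = (\<Oplus>x\<in>X. x \<otimes> restrict d X x)" by auto
    with ex1[OF y] c[OF y] have "restrict d X = c y" by blast
    then show ?thesis using x by (metis restrict_apply')
  qed
  define e where "e x = (\<lambda>y\<in>carrier R. c y x)" for x
  have e_add: "c (y \<oplus> z) x = c y x \<oplus> c z x" if yz: "y \<in> carrier R" "z \<in> carrier R" and x: "x \<in> X" for x y z
  proof (rule uniq[symmetric, OF _ _ _ x])
    have "y \<oplus> z = (\<Oplus>x\<in>X. x \<otimes> c y x) \<oplus> (\<Oplus>x\<in>X. x \<otimes> c z x)" using c yz by metis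
    also have "\<dots> = (\<Oplus>x\<in>X. x \<otimes> c y x \<oplus> x \<otimes> c z x)"
      by (rule finsum_addf[symmetric]) (use X Bc cB yz in auto)
    also have "\<dots> = (\<Oplus>x\<in>X. x \<otimes> (c y x \<oplus> c z x))"
      by (intro finsum_cong') (use X Bc cB yz in \<open>auto simp: r_distr subset_eq\<close>)
    finally show "y \<oplus> z = (\<Oplus>x\<in>X. x \<otimes> (c y x \<oplus> c z x))" .
  qed (use yz cB subringE(7)[OF B] in auto)
  have e_scale: "c (y \<otimes> b) x = c y x \<otimes> b" if y: "y \<in> carrier R" and b: "b \<in> B" and x: "x \<in> X" for x y b
  proof (rule uniq[symmetric, OF _ _ _ x])
    have "y \<otimes> b = (\<Oplus>x\<in>X. x \<otimes> c y x) \<otimes> b" using c y by metis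
    also have "\<dots> = (\<Oplus>x\<in>X. x \<otimes> c y x \<otimes> b)"
      by (rule finsum_ldistr) (use X Bc cB y b in auto)
    also have "\<dots> = (\<Oplus>x\<in>X. x \<otimes> (c y x \<otimes> b))"
      by (intro finsum_cong') (use X Bc cB y b in \<open>auto simp: m_assoc subset_eq\<close>)
    finally show "y \<otimes> b = (\<Oplus>x\<in>X. x \<otimes> (c y x \<otimes> b))" .
  qed (use y b Bc cB subringE(6)[OF B] in auto)
  have delta: "c z x = (if x = z then \<one> else \<zero>)" if z: "z \<in> X" and x: "x \<in> X" for x z
  proof (rule uniq[symmetric, OF _ _ _ x])
    have "(\<Oplus>x\<in>X. x \<otimes> (if x = z then \<one> else \<zero>)) = (\<Oplus>x\<in>X. if z = x then x else \<zero>)"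
      using X by (intro finsum_cong') auto
    also have "\<dots> = z" by (rule finsum_singleton) (use X z in auto)
    finally show "z = (\<Oplus>x\<in>X. x \<otimes> (if x = z then \<one> else \<zero>))" by simp
  qed (use X z subringE(2,3)[OF B] in auto)
  have "e x \<in> End_right R B" if x: "x \<in> X" for x
  proof -
    have "e x \<in> carrier (End_ring R)"
      by (rule End_ringI) (use x cB Bc e_add in \<open>auto simp: e_def\<close>)
    then show ?thesis using x Bc e_scale by (auto simp: End_right_def e_def)
  qed
  moreover have "e x y = (if x = y then \<one> else \<zero>)" if "x \<in> X" "y \<in> X" for x y
    using X delta that by (auto simp: e_def)
  moreover have "y = (\<Oplus>x\<in>X. x \<otimes> e x y)" if "y \<in> carrier R" for y
    using c[OF that] that by (simp add: e_def)
  ultimately have "right_coordinates R B X e"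
    using X cB unfolding right_coordinates_def dual_system_def by (auto simp: e_def)
  then show thesis by (rule that)
qed

text \<open>
  A \<open>B\<close>-linear map is determined by its values on a basis. In this form the lemma shows both that
  the coordinate functionals generate \<open>End_right R B\<close> and that a subring containing them and the
  left multiplications is all of \<open>End_right R B\<close>.
\<close>

lemma End_right_expansion:
  assumes B: "B \<subseteq> carrier R" and co: "right_coordinates R B X e" and f: "f \<in> End_right R B"
  shows "f = (\<Oplus>\<^bsub>End_ring R\<^esub>x\<in>X. left_mult R (f x) \<otimes>\<^bsub>End_ring R\<^esub> e x)"
proof -
  interpret E: ring "End_ring R" by (rule End_ring_is_ring)
  have fE: "f \<in> carrier (End_ring R)" using f by (simp add: End_right_def)
  have X: "X \<subseteq> carrier R" and eE: "\<And>x. x \<in> X \<Longrightarrow> e x \<in> carrier (End_ring R)"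
    and eB: "\<And>x y. x \<in> X \<Longrightarrow> y \<in> carrier R \<Longrightarrow> e x y \<in> B"
    using co by (auto simp: right_coordinates_def dual_system_def End_right_def)
  have fc: "f x \<in> carrier R" if "x \<in> X" for x using X that End_ringD(1)[OF fE] by auto
  have t: "(\<lambda>x. left_mult R (f x) \<otimes>\<^bsub>End_ring R\<^esub> e x) \<in> X \<rightarrow> carrier (End_ring R)"
    using fc eE left_mult_closed by auto
  show ?thesis
  proof (rule End_ring_eqI[OF fE])
    show "(\<Oplus>\<^bsub>End_ring R\<^esub>x\<in>X. left_mult R (f x) \<otimes>\<^bsub>End_ring R\<^esub> e x) \<in> carrier (End_ring R)"
      by (rule E.finsum_closed[OF t])
    fix y assume y: "y \<in> carrier R"
    have ec: "e x y \<in> carrier R" if "x \<in> X" for x using eB[OF that y] B by auto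
    have "f y = f (\<Oplus>x\<in>X. x \<otimes> e x y)" using co y by (simp add: right_coordinates_def)
    also have "\<dots> = (\<Oplus>x\<in>X. f (x \<otimes> e x y))"
      by (rule End_ring_finsum[OF fE]) (use X ec in auto)
    also have "\<dots> = (\<Oplus>x\<in>X. (left_mult R (f x) \<otimes>\<^bsub>End_ring R\<^esub> e x) y)"
    proof (intro finsum_cong' refl)
      fix x assume x: "x \<in> X"
      show "f (x \<otimes> e x y) = (left_mult R (f x) \<otimes>\<^bsub>End_ring R\<^esub> e x) y"
        using End_right_apply[OF f _ eB[OF x y], of x] X x y ec[OF x] by (auto simp: End_ring_apply)
    qed (use End_ringD(1)[OF funcset_mem[OF t] y] in auto)
    also have "\<dots> = (\<Oplus>\<^bsub>End_ring R\<^esub>x\<in>X. left_mult R (f x) \<otimes>\<^bsub>End_ring R\<^esub> e x) y"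
      by (rule End_ring_finsum_apply[OF t y, symmetric])
    finally show "f y = (\<Oplus>\<^bsub>End_ring R\<^esub>x\<in>X. left_mult R (f x) \<otimes>\<^bsub>End_ring R\<^esub> e x) y" .
  qed
qed

end

section \<open>From division subrings to Galois subrings\<close>

context ring
begin

lemma fin_gen_left_End_right:
  assumes one: "\<one> \<noteq> \<zero>" and B: "B \<subseteq> carrier R" and co: "right_coordinates R B X e"
  shows "fin_gen_left (End_ring R) (left_mults R) (End_right R B)"
  unfolding fin_gen_left_def
proof (intro exI conjI)
  interpret E: ring "End_ring R" by (rule End_ring_is_ring)
  have X: "finite X" "X \<subseteq> carrier R" and eR: "\<And>x. x \<in> X \<Longrightarrow> e x \<in> End_right R B"
    and d: "\<And>x y. x \<in> X \<Longrightarrow> y \<in> X \<Longrightarrow> e x y = (if x = y then \<one> else \<zero>)"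
    using co by (auto simp: right_coordinates_def dual_system_def)
  note sub = subring_End_right[OF B]
  have inj: "inj_on e X"
    by (rule inj_onI) (metis d one)
  show "finite (e ` X)" "e ` X \<subseteq> End_right R B" using X eR by auto
  show "End_right R B = left_span (End_ring R) (left_mults R) (e ` X)"
  proof
    show "End_right R B \<subseteq> left_span (End_ring R) (left_mults R) (e ` X)"
    proof
      fix f assume f: "f \<in> End_right R B"
      \<comment> \<open>The generating set consists of maps, so the coefficients are indexed by the functionals
        rather than by the basis; distinct basis elements give distinct functionals.\<close>
      let ?c = "\<lambda>g. left_mult R (f (the_inv_into X e g))"
      have c: "?c \<in> e ` X \<rightarrow> left_mults R"
        using f X inj End_ringD(1)[of f R] by (auto simp: left_mults_def End_right_def the_inv_into_f_f)
      then have cg: "(\<lambda>g. ?c g \<otimes>\<^bsub>End_ring R\<^esub> g) \<in> e ` X \<rightarrow> carrier (End_ring R)"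
        using left_mults_subset_End_right[OF B] subringE(1)[OF sub] eR by fast
      have "(\<Oplus>\<^bsub>End_ring R\<^esub>g\<in>e ` X. ?c g \<otimes>\<^bsub>End_ring R\<^esub> g)
          = (\<Oplus>\<^bsub>End_ring R\<^esub>x\<in>X. ?c (e x) \<otimes>\<^bsub>End_ring R\<^esub> e x)"
        by (rule E.finsum_reindex[OF cg inj])
      also have "\<dots> = (\<Oplus>\<^bsub>End_ring R\<^esub>x\<in>X. left_mult R (f x) \<otimes>\<^bsub>End_ring R\<^esub> e x)"
        by (intro E.finsum_cong') (use cg inj in \<open>auto simp: the_inv_into_f_f Pi_iff\<close>)
      also have "\<dots> = f" by (rule End_right_expansion[OF B co f, symmetric])
      finally have "f = (\<Oplus>\<^bsub>End_ring R\<^esub>g\<in>e ` X. ?c g \<otimes>\<^bsub>End_ring R\<^esub> g)" by (rule sym)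
      then show "f \<in> left_span (End_ring R) (left_mults R) (e ` X)"
        unfolding left_span_def mem_Collect_eq by (intro exI[of _ ?c] conjI c)
    qed
    show "left_span (End_ring R) (left_mults R) (e ` X) \<subseteq> End_right R B"
    proof
      fix f assume "f \<in> left_span (End_ring R) (left_mults R) (e ` X)"
      then obtain c where c: "c \<in> e ` X \<rightarrow> left_mults R"
        and f: "f = (\<Oplus>\<^bsub>End_ring R\<^esub>g\<in>e ` X. c g \<otimes>\<^bsub>End_ring R\<^esub> g)"
        unfolding left_span_def mem_Collect_eq by (elim exE conjE) (rule that; assumption)
      show "f \<in> End_right R B"
        unfolding f
      proof (rule E.subring_finsum_closed[OF sub], rule Pi_I)
        fix g assume g: "g \<in> e ` X"
        have "c g \<in> End_right R B"
          using funcset_mem[OF c g] left_mults_subset_End_right[OF B] by (rule subsetD[rotated])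
        moreover have "g \<in> End_right R B" using g eR by (elim imageE) simp
        ultimately show "c g \<otimes>\<^bsub>End_ring R\<^esub> g \<in> End_right R B" by (rule subringE(6)[OF sub])
      qed
    qed
  qed
qed

text \<open>
  If \<open>e x y\<close> has the left inverse \<open>b\<close>, then \<open>e x\<close> followed by left multiplication by
  \<open>a \<otimes> b\<close> sends \<open>y\<close> to \<open>a\<close>, so each nonzero \<open>y\<close> generates the whole module.
\<close>

lemma simple_End_right:
  assumes one: "\<one> \<noteq> \<zero>" and B: "B \<subseteq> carrier R" and co: "right_coordinates R B X e"
    and div: "\<And>b. b \<in> B \<Longrightarrow> b \<noteq> \<zero> \<Longrightarrow> \<exists>b'\<in>B. b' \<otimes> b = \<one>"
  shows "simple_by_evaluation R (End_right R B)"
  unfolding simple_by_evaluation_def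
proof (intro conjI allI impI)
  show "carrier R \<noteq> {\<zero>}" using one one_closed by blast
  have X: "X \<subseteq> carrier R" and eR: "\<And>x. x \<in> X \<Longrightarrow> e x \<in> End_right R B"
    and eB: "\<And>x y. x \<in> X \<Longrightarrow> y \<in> carrier R \<Longrightarrow> e x y \<in> B"
    and sum: "\<And>y. y \<in> carrier R \<Longrightarrow> y = (\<Oplus>x\<in>X. x \<otimes> e x y)"
    using co by (auto simp: right_coordinates_def dual_system_def)
  fix N assume N: "additive_subgroup N R \<and> (\<forall>f\<in>End_right R B. \<forall>x\<in>N. f x \<in> N)"
  then interpret N: additive_subgroup N R by simp
  show "N = {\<zero>} \<or> N = carrier R"
  proof (rule disjCI)
    assume "N \<noteq> carrier R"
    have "y = \<zero>" if y: "y \<in> N" for y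
    proof (rule ccontr)
      assume "y \<noteq> \<zero>"
      have yc: "y \<in> carrier R" using y N.a_subset by auto
      have "\<exists>x\<in>X. e x y \<noteq> \<zero>"
      proof (rule ccontr)
        assume "\<not> ?thesis"
        then have "(\<Oplus>x\<in>X. x \<otimes> e x y) = (\<Oplus>x\<in>X. \<zero>)"
          using X by (intro finsum_cong') auto
        then show False using sum[OF yc] \<open>y \<noteq> \<zero>\<close> by simp
      qed
      then obtain x b where x: "x \<in> X" and b: "b \<in> B" "b \<otimes> e x y = \<one>"
        using div eB yc by metis
      have "a \<in> N" if a: "a \<in> carrier R" for a
      proof -
        have bc: "b \<in> carrier R" "e x y \<in> carrier R" using b B eB[OF x yc] by auto
        have "left_mult R (a \<otimes> b) \<in> End_right R B"
          using left_mults_subset_End_right[OF B] a bc by (auto simp: left_mults_def)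
        then have "left_mult R (a \<otimes> b) (e x y) \<in> N" using N eR[OF x] y by blast
        moreover have "left_mult R (a \<otimes> b) (e x y) = a"
          using a b bc by (simp add: End_ring_apply m_assoc)
        ultimately show ?thesis by simp
      qed
      then show False using \<open>N \<noteq> carrier R\<close> N.a_subset by auto
    qed
    then show "N = {\<zero>}" using N.zero_closed by blast
  qed
qed

lemma End_left_elems_iff:
  assumes "\<And>f. f \<in> \<R> \<Longrightarrow> f \<in> carrier (End_ring R)"
  shows "x \<in> End_left_elems R \<R> \<longleftrightarrow>
    x \<in> carrier R \<and> (\<forall>f\<in>\<R>. \<forall>a\<in>carrier R. f (a \<otimes> x) = f a \<otimes> x)"
proof -
  have "right_mult R x \<in> carrier (End_ring R)" if "x \<in> carrier R"
    by (rule End_ringI) (use that in \<open>auto simp: right_mult_def l_distr\<close>)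
  moreover have "right_mult R x (f a) = f a \<otimes> x" "right_mult R x a = a \<otimes> x"
    if "f \<in> \<R>" "a \<in> carrier R" for f a
    using that assms End_ringD(1)[of f R a] by (auto simp: right_mult_def)
  ultimately show ?thesis
    unfolding End_left_elems_def End_left_def by (auto simp: eq_commute)
qed

text \<open>
  For \<open>x\<close> in the left hand side, \<open>e z \<one> \<otimes> x = e z x\<close> is an element of \<open>B\<close>; choosing \<open>z\<close> with
  \<open>e z \<one> \<noteq> \<zero>\<close> and cancelling this element of \<open>B\<close> leaves \<open>x\<close>.
\<close>

lemma End_left_elems_End_right:
  assumes one: "\<one> \<noteq> \<zero>" and B: "subring B R" and co: "right_coordinates R B X e"
    and div: "\<And>b. b \<in> B \<Longrightarrow> b \<noteq> \<zero> \<Longrightarrow> \<exists>b'\<in>B. b' \<otimes> b = \<one>"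
  shows "End_left_elems R (End_right R B) = B"
proof
  note Bc = subringE(1)[OF B]
  have E: "\<And>f. f \<in> End_right R B \<Longrightarrow> f \<in> carrier (End_ring R)" by (simp add: End_right_def)
  show "B \<subseteq> End_left_elems R (End_right R B)"
    using Bc by (auto simp: End_left_elems_iff[OF E] End_right_apply)
  have X: "X \<subseteq> carrier R" and eR: "\<And>x. x \<in> X \<Longrightarrow> e x \<in> End_right R B"
    and eB: "\<And>x y. x \<in> X \<Longrightarrow> y \<in> carrier R \<Longrightarrow> e x y \<in> B"
    and sum: "\<And>y. y \<in> carrier R \<Longrightarrow> y = (\<Oplus>x\<in>X. x \<otimes> e x y)"
    using co by (auto simp: right_coordinates_def dual_system_def)
  have "\<exists>z\<in>X. e z \<one> \<noteq> \<zero>"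
  proof (rule ccontr)
    assume "\<not> ?thesis"
    then have "(\<Oplus>x\<in>X. x \<otimes> e x \<one>) = (\<Oplus>x\<in>X. \<zero>)"
      using X by (intro finsum_cong') auto
    then show False using sum[of \<one>] one by simp
  qed
  then obtain z b where z: "z \<in> X" and b: "b \<in> B" "b \<otimes> e z \<one> = \<one>"
    using div eB one_closed by metis
  show "End_left_elems R (End_right R B) \<subseteq> B"
  proof
    fix x assume "x \<in> End_left_elems R (End_right R B)"
    then have x: "x \<in> carrier R" and ez: "e z (\<one> \<otimes> x) = e z \<one> \<otimes> x"
      using eR[OF z] by (auto simp: End_left_elems_iff[OF E])
    have c: "b \<in> carrier R" "e z \<one> \<in> carrier R" using Bc b(1) eB[OF z one_closed] by auto
    have "b \<otimes> e z x = (b \<otimes> e z \<one>) \<otimes> x" using ez c x by (simp add: m_assoc)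
    then have "b \<otimes> e z x = x" using b x by simp
    then show "x \<in> B" using subringE(6)[OF B b(1) eB[OF z x]] by simp
  qed
qed

end

section \<open>From Galois subrings to division subrings\<close>

locale simple_endomorphism_subring = ring R for R (structure) +
  fixes \<R>
  assumes subring: "subring \<R> (End_ring R)"
    and left_mults: "left_mults R \<subseteq> \<R>"
    and simple: "simple_by_evaluation R \<R>"
begin

abbreviation centralizer where "centralizer \<equiv> End_left_elems R \<R>"

lemma one_neq_zero: "\<one> \<noteq> \<zero>"
proof
  assume "\<one> = \<zero>"
  then have "carrier R = {\<zero>}" using one_zeroD by simp
  then show False using simple by (simp add: simple_by_evaluation_def)
qed

lemma in_End: "f \<in> \<R> \<Longrightarrow> f \<in> carrier (End_ring R)"
  using subringE(1)[OF subring] by auto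

lemma left_mult_mem: "a \<in> carrier R \<Longrightarrow> left_mult R a \<in> \<R>"
  using left_mults by (auto simp: left_mults_def)

lemmas closed = End_ringD(1)[OF in_End]

lemmas centralizer_iff = End_left_elems_iff[OF in_End, of \<R>, simplified]

text \<open>
  Negation is left multiplication by \<open>\<ominus> \<one>\<close>, so stability under \<open>\<R>\<close> makes closure under addition
  enough for a subgroup.
\<close>

lemma submodule_eq_carrier:
  assumes "N \<subseteq> carrier R" and "\<And>x y. x \<in> N \<Longrightarrow> y \<in> N \<Longrightarrow> x \<oplus> y \<in> N"
    and stable: "\<And>f x. f \<in> \<R> \<Longrightarrow> x \<in> N \<Longrightarrow> f x \<in> N"
    and y: "y \<in> N" "y \<noteq> \<zero>"
  shows "N = carrier R"
proof -
  have "\<ominus> x \<in> N" if "x \<in> N" for x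
    using stable[OF left_mult_mem that, of "\<ominus> \<one>"] assms(1) that
    by (auto simp: End_ring_apply l_minus)
  moreover have "N \<noteq> {}" using y by auto
  ultimately have "additive_subgroup N R"
    using assms(1,2) by (intro additive_subgroupI add.subgroupI) (auto simp: a_inv_def)
  then show ?thesis
    using simple stable y unfolding simple_by_evaluation_def by blast
qed

lemma centralizer_subring: "subring centralizer R"
proof (rule subringI)
  fix x y assume "x \<in> centralizer" "y \<in> centralizer"
  then have x: "x \<in> carrier R" "\<And>f a. f \<in> \<R> \<Longrightarrow> a \<in> carrier R \<Longrightarrow> f (a \<otimes> x) = f a \<otimes> x"
    and y: "y \<in> carrier R" "\<And>f a. f \<in> \<R> \<Longrightarrow> a \<in> carrier R \<Longrightarrow> f (a \<otimes> y) = f a \<otimes> y"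
    by (auto simp: centralizer_iff)
  show "x \<otimes> y \<in> centralizer"
    using x y by (auto simp: centralizer_iff closed m_assoc[symmetric])
  show "x \<oplus> y \<in> centralizer"
    using x y by (auto simp: centralizer_iff closed r_distr End_ringD(2)[OF in_End])
next
  fix x assume x: "x \<in> centralizer"
  have "f (a \<otimes> \<ominus> x) = f a \<otimes> \<ominus> x" if f: "f \<in> \<R>" and a: "a \<in> carrier R" for f a
  proof -
    have xc: "x \<in> carrier R" using x by (simp add: centralizer_iff)
    have "f (\<ominus> a \<otimes> x) = f (\<ominus> a) \<otimes> x" using x f a by (simp add: centralizer_iff)
    moreover have "f (\<ominus> a) = \<ominus> f a"
    proof -
      have "f (\<ominus> a) \<oplus> f a = f (\<ominus> a \<oplus> a)"
        using f a by (simp add: End_ringD(2)[OF in_End])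
      also have "\<dots> = \<zero>" using f a by (simp add: l_neg End_ring_zero[OF in_End])
      finally show ?thesis using f a by (metis closed a_inv_closed minus_equality)
    qed
    ultimately show ?thesis using xc a closed[OF f a] by (simp add: l_minus r_minus)
  qed
  with x show "\<ominus> x \<in> centralizer" by (simp add: centralizer_iff)
qed (auto simp: centralizer_iff closed)

text \<open>
  Schur's lemma for right multiplication by \<open>x\<close>: its image and its kernel are submodules, so it is
  bijective, and the preimage of \<open>\<one>\<close> is the inverse of \<open>x\<close>.
\<close>

lemma centralizer_inverse:
  assumes x: "x \<in> centralizer" and "x \<noteq> \<zero>"
  obtains u where "u \<in> centralizer" and "u \<otimes> x = \<one>" and "x \<otimes> u = \<one>"
proof -
  have xc: "x \<in> carrier R" and comm: "\<And>f a. f \<in> \<R> \<Longrightarrow> a \<in> carrier R \<Longrightarrow> f (a \<otimes> x) = f a \<otimes> x"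
    using x by (auto simp: centralizer_iff)
  have "(\<lambda>a. a \<otimes> x) ` carrier R = carrier R"
  proof (rule submodule_eq_carrier)
    show "\<one> \<otimes> x \<in> (\<lambda>a. a \<otimes> x) ` carrier R" by blast
    show "\<one> \<otimes> x \<noteq> \<zero>" using assms(2) xc by simp
    fix a b assume "a \<in> (\<lambda>a. a \<otimes> x) ` carrier R" "b \<in> (\<lambda>a. a \<otimes> x) ` carrier R"
    then show "a \<oplus> b \<in> (\<lambda>a. a \<otimes> x) ` carrier R"
      using xc by (auto simp: l_distr[symmetric])
    fix f assume "f \<in> \<R>"
    moreover obtain c where "c \<in> carrier R" "a = c \<otimes> x"
      using \<open>a \<in> (\<lambda>a. a \<otimes> x) ` carrier R\<close> by blast
    ultimately show "f a \<in> (\<lambda>a. a \<otimes> x) ` carrier R"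
      using comm[of f c] closed[of f c] by simp
  qed (use xc in auto)
  then have "\<one> \<in> (\<lambda>a. a \<otimes> x) ` carrier R" by simp
  then obtain u where u: "u \<in> carrier R" "u \<otimes> x = \<one>" by (elim imageE) simp
  have cancel: "a = \<zero>" if "a \<in> carrier R" "a \<otimes> x = \<zero>" for a
  proof (rule ccontr)
    assume "a \<noteq> \<zero>"
    have "{a \<in> carrier R. a \<otimes> x = \<zero>} = carrier R"
    proof (rule submodule_eq_carrier)
      show "a \<in> {a \<in> carrier R. a \<otimes> x = \<zero>}" "a \<noteq> \<zero>" using that \<open>a \<noteq> \<zero>\<close> by auto
      fix f c assume "f \<in> \<R>" "c \<in> {a \<in> carrier R. a \<otimes> x = \<zero>}"
      then show "f c \<in> {a \<in> carrier R. a \<otimes> x = \<zero>}"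
        using comm[of f c] closed[of f c] End_ring_zero[OF in_End, of f] by simp
    qed (use xc in \<open>auto simp: l_distr\<close>)
    then have "\<one> \<otimes> x = \<zero>" using one_closed by blast
    then show False using assms(2) xc by simp
  qed
  have cancel_eq: "a = b" if "a \<in> carrier R" "b \<in> carrier R" "a \<otimes> x = b \<otimes> x" for a b
    using cancel[of "a \<ominus> b"] r_right_minus_eq[of a b] that xc by (simp add: minus_eq l_distr l_minus r_neg)
  have "x \<otimes> u = \<one>"
    by (rule cancel_eq) (use u xc in \<open>auto simp: m_assoc\<close>)
  moreover have "u \<in> centralizer"
    unfolding centralizer_iff
  proof (intro conjI ballI u)
    fix f a assume f: "f \<in> \<R>" and a: "a \<in> carrier R"
    have "f (a \<otimes> u) \<otimes> x = f (a \<otimes> u \<otimes> x)" using comm f a u by simp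
    also have "\<dots> = f a" using a u xc by (simp add: m_assoc)
    also have "\<dots> = f a \<otimes> u \<otimes> x" using closed[OF f a] u xc by (simp add: m_assoc)
    finally show "f (a \<otimes> u) = f a \<otimes> u"
      by (rule cancel_eq[rotated 2]) (use closed f a u in auto)
  qed
  ultimately show thesis using that u by blast
qed

lemma centralizer_skew_field: "skew_field (R\<lparr>carrier := centralizer\<rparr>)"
proof (intro skew_field.intro skew_field_axioms.intro)
  show "ring (R\<lparr>carrier := centralizer\<rparr>)" by (rule subring_is_ring[OF centralizer_subring])
  have "\<zero> \<notin> Units (R\<lparr>carrier := centralizer\<rparr>)"
    using one_neq_zero by (auto simp: Units_def centralizer_iff)
  moreover have "x \<in> Units (R\<lparr>carrier := centralizer\<rparr>)" if "x \<in> centralizer" "x \<noteq> \<zero>" for x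
    using centralizer_inverse[OF that] that(1) by (auto simp: Units_def)
  ultimately show "Units (R\<lparr>carrier := centralizer\<rparr>) =
      carrier (R\<lparr>carrier := centralizer\<rparr>) - {\<zero>\<^bsub>R\<lparr>carrier := centralizer\<rparr>\<^esub>}"
    by (auto simp: Units_def)
qed

text \<open>
  The members of \<open>\<R>\<close> that vanish on \<open>X\<close> form a left ideal, so their values at \<open>y\<close> form a submodule.
  It is nonzero, hence contains \<open>\<one>\<close>. This gives the functional for \<open>y\<close>, and subtracting a multiple
  of it makes the old functionals vanish at \<open>y\<close>.
\<close>

lemma dual_system_extend:
  assumes ds: "dual_system R \<R> X e" and j: "j \<in> \<R>" "\<And>x. x \<in> X \<Longrightarrow> j x = \<zero>"
    and y: "y \<in> carrier R" "j y \<noteq> \<zero>"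
  obtains e' where "y \<notin> X" and "dual_system R \<R> (insert y X) e'"
proof -
  have X: "finite X" "X \<subseteq> carrier R" and eR: "\<And>x. x \<in> X \<Longrightarrow> e x \<in> \<R>"
    and d: "\<And>x z. x \<in> X \<Longrightarrow> z \<in> X \<Longrightarrow> e x z = (if x = z then \<one> else \<zero>)"
    using ds by (auto simp: dual_system_def)
  have ynX: "y \<notin> X" using j y by auto
  define J where "J = {g \<in> \<R>. \<forall>x\<in>X. g x = \<zero>}"
  have "(\<lambda>g. g y) ` J = carrier R"
  proof (rule submodule_eq_carrier)
    show "j y \<in> (\<lambda>g. g y) ` J" using j by (auto simp: J_def)
    show "j y \<noteq> \<zero>" by (rule y)
    show "(\<lambda>g. g y) ` J \<subseteq> carrier R" using y closed by (auto simp: J_def)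
    fix a b assume "a \<in> (\<lambda>g. g y) ` J" "b \<in> (\<lambda>g. g y) ` J"
    then obtain g k where gk: "g \<in> J" "k \<in> J" "a = g y" "b = k y" by blast
    have "g \<oplus>\<^bsub>End_ring R\<^esub> k \<in> J"
      using gk X subringE(7)[OF subring] by (auto simp: J_def End_ring_apply subset_eq)
    then show "a \<oplus> b \<in> (\<lambda>g. g y) ` J"
      by (rule image_eqI[rotated]) (use gk y in \<open>simp add: End_ring_apply\<close>)
  next
    fix f a assume f: "f \<in> \<R>" and "a \<in> (\<lambda>g. g y) ` J"
    then obtain g where g: "g \<in> J" "a = g y" by blast
    have "f \<otimes>\<^bsub>End_ring R\<^esub> g \<in> J"
      using f g X subringE(6)[OF subring] End_ring_zero[OF in_End[OF f]]
      by (auto simp: J_def End_ring_apply subset_eq)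
    then show "f a \<in> (\<lambda>g. g y) ` J"
      by (rule image_eqI[rotated]) (use g y in \<open>simp add: End_ring_apply\<close>)
  qed
  then obtain g where g: "g \<in> \<R>" "\<And>x. x \<in> X \<Longrightarrow> g x = \<zero>" "g y = \<one>"
  proof -
    have "\<one> \<in> (\<lambda>g. g y) ` J" using \<open>(\<lambda>g. g y) ` J = carrier R\<close> by simp
    then obtain g where "g \<in> J" "g y = \<one>" by (elim imageE) simp
    then show thesis using that unfolding J_def by blast
  qed
  define e' where "e' x = (if x = y then g
    else e x \<oplus>\<^bsub>End_ring R\<^esub> left_mult R (\<ominus> e x y) \<otimes>\<^bsub>End_ring R\<^esub> g)" for x
  have eyc: "e x y \<in> carrier R" if "x \<in> X" for x using closed[OF eR[OF that] y(1)] .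
  have "e' x \<in> \<R>" if "x \<in> insert y X" for x
    using that g(1) eyc eR by (auto simp: e'_def intro!: subringE(6,7)[OF subring] left_mult_mem)
  moreover have "e' x z = (if x = z then \<one> else \<zero>)" if "x \<in> insert y X" "z \<in> insert y X" for x z
  proof -
    have "z \<in> carrier R" using that X y by auto
    then show ?thesis
      using that X y g d ynX eyc
      by (auto simp: e'_def End_ring_apply r_neg closed)
  qed
  ultimately have "dual_system R \<R> (insert y X) e'"
    using X y by (auto simp: dual_system_def)
  with ynX show thesis by (rule that)
qed

text \<open>
  By maximality, equality in \<open>\<R>\<close> can be tested on \<open>X\<close>. Both required identities compare two
  members of \<open>\<R>\<close> that visibly agree on \<open>X\<close>.
\<close>

lemma right_coordinates_if_maximal:
  assumes ds: "dual_system R \<R> X e"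
    and max: "\<And>X' e'. dual_system R \<R> X' e' \<Longrightarrow> card X' \<le> card X"
  shows "right_coordinates R centralizer X e"
proof -
  interpret E: ring "End_ring R" by (rule End_ring_is_ring)
  have X: "finite X" "X \<subseteq> carrier R" and eR: "\<And>x. x \<in> X \<Longrightarrow> e x \<in> \<R>"
    and d: "\<And>x z. x \<in> X \<Longrightarrow> z \<in> X \<Longrightarrow> e x z = (if x = z then \<one> else \<zero>)"
    using ds by (auto simp: dual_system_def)
  have vanish: "j y = \<zero>" if "j \<in> \<R>" "\<And>x. x \<in> X \<Longrightarrow> j x = \<zero>" "y \<in> carrier R" for j y
  proof (rule ccontr)
    assume "j y \<noteq> \<zero>"
    with dual_system_extend[OF ds that] obtain e' where
      "y \<notin> X" "dual_system R \<R> (insert y X) e'" by blast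
    then show False using max[of "insert y X" e'] X by simp
  qed
  have determined: "f y = g y"
    if f: "f \<in> \<R>" and g: "g \<in> \<R>" and eq: "\<And>x. x \<in> X \<Longrightarrow> f x = g x" and y: "y \<in> carrier R" for f g y
  proof -
    let ?j = "f \<oplus>\<^bsub>End_ring R\<^esub> \<ominus>\<^bsub>End_ring R\<^esub> g"
    have j: "?j z = f z \<ominus> g z" if "z \<in> carrier R" for z
      using that g by (simp add: End_ring_apply End_ring_a_inv_apply in_End minus_eq)
    have "?j y = \<zero>"
    proof (rule vanish[OF _ _ y])
      show "?j \<in> \<R>" using f g subringE(5,7)[OF subring] by blast
      fix x assume "x \<in> X"
      then show "?j x = \<zero>" using j[of x] X eq closed[OF g, of x] by (auto simp: minus_eq r_neg)
    qed
    then show ?thesis using j[OF y] closed[OF f y] closed[OF g y] by simp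
  qed
  have central: "e x y \<in> centralizer" if x: "x \<in> X" and y: "y \<in> carrier R" for x y
    unfolding centralizer_iff
  proof (intro conjI ballI)
    show eyc: "e x y \<in> carrier R" using closed eR x y by blast
    fix f a assume f: "f \<in> \<R>" and a: "a \<in> carrier R"
    let ?f1 = "f \<otimes>\<^bsub>End_ring R\<^esub> (left_mult R a \<otimes>\<^bsub>End_ring R\<^esub> e x)"
    let ?f2 = "left_mult R (f a) \<otimes>\<^bsub>End_ring R\<^esub> e x"
    have ap: "?f1 z = f (a \<otimes> e x z)" "?f2 z = f a \<otimes> e x z" if "z \<in> carrier R" for z
      using that closed[OF eR[OF x] that] by (simp_all add: End_ring_apply)
    have "?f1 y = ?f2 y"
    proof (rule determined[OF _ _ _ y])
      show "?f1 \<in> \<R>" "?f2 \<in> \<R>"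
        using f a x eR closed[OF f a] by (auto intro!: subringE(6)[OF subring] left_mult_mem)
      fix z assume z: "z \<in> X"
      then have "z \<in> carrier R" using X by auto
      then show "?f1 z = ?f2 z"
        using ap[of z] d[OF x z] a closed[OF f a] End_ring_zero[OF in_End[OF f]] by auto
    qed
    then show "f (a \<otimes> e x y) = f a \<otimes> e x y" using ap y by simp
  qed
  have expand: "y = (\<Oplus>x\<in>X. x \<otimes> e x y)" if y: "y \<in> carrier R" for y
  proof -
    let ?t = "\<lambda>x. left_mult R x \<otimes>\<^bsub>End_ring R\<^esub> e x"
    have t: "?t \<in> X \<rightarrow> \<R>"
      using X eR by (auto intro!: subringE(6)[OF subring] left_mult_mem)
    have ap: "(\<Oplus>\<^bsub>End_ring R\<^esub>x\<in>X. ?t x) z = (\<Oplus>x\<in>X. x \<otimes> e x z)" if z: "z \<in> carrier R" for z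
    proof -
      have "(\<Oplus>\<^bsub>End_ring R\<^esub>x\<in>X. ?t x) z = (\<Oplus>x\<in>X. ?t x z)"
        using t in_End by (intro End_ring_finsum_apply z) auto
      also have "\<dots> = (\<Oplus>x\<in>X. x \<otimes> e x z)"
        using X closed[OF eR z] z by (intro finsum_cong') (auto simp: End_ring_apply)
      finally show ?thesis .
    qed
    have "\<one>\<^bsub>End_ring R\<^esub> y = (\<Oplus>\<^bsub>End_ring R\<^esub>x\<in>X. ?t x) y"
    proof (rule determined[OF _ _ _ y])
      show "\<one>\<^bsub>End_ring R\<^esub> \<in> \<R>" by (rule subringE(3)[OF subring])
      show "(\<Oplus>\<^bsub>End_ring R\<^esub>x\<in>X. ?t x) \<in> \<R>" by (rule E.subring_finsum_closed[OF subring t])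
      fix z assume z: "z \<in> X"
      then have zc: "z \<in> carrier R" using X by auto
      have "(\<Oplus>x\<in>X. x \<otimes> e x z) = (\<Oplus>x\<in>X. if z = x then x else \<zero>)"
        using X d[OF _ z] by (intro finsum_cong') auto
      also have "\<dots> = z" by (rule finsum_singleton) (use X z in auto)
      finally show "\<one>\<^bsub>End_ring R\<^esub> z = (\<Oplus>\<^bsub>End_ring R\<^esub>x\<in>X. ?t x) z"
        using ap[OF zc] zc by (simp add: End_ring_apply)
    qed
    then show ?thesis using ap[OF y] y by (simp add: End_ring_apply)
  qed
  have "\<R> \<subseteq> End_right R centralizer"
    using in_End by (auto simp: End_right_def centralizer_iff)
  then show ?thesis
    unfolding right_coordinates_def using ds central expand by (auto simp: dual_system_def)
qed

lemma End_right_centralizer: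
  assumes ds: "dual_system R \<R> X e" and co: "right_coordinates R centralizer X e"
  shows "End_right R centralizer = \<R>"
proof
  interpret E: ring "End_ring R" by (rule End_ring_is_ring)
  show "\<R> \<subseteq> End_right R centralizer"
    using in_End by (auto simp: End_right_def centralizer_iff)
  show "End_right R centralizer \<subseteq> \<R>"
  proof
    fix f assume f: "f \<in> End_right R centralizer"
    have "(\<lambda>x. left_mult R (f x) \<otimes>\<^bsub>End_ring R\<^esub> e x) \<in> X \<rightarrow> \<R>"
      using ds f End_ringD(1)[of f R]
      by (auto simp: dual_system_def End_right_def intro!: subringE(6)[OF subring] left_mult_mem)
    then have "(\<Oplus>\<^bsub>End_ring R\<^esub>x\<in>X. left_mult R (f x) \<otimes>\<^bsub>End_ring R\<^esub> e x) \<in> \<R>"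
      by (rule E.subring_finsum_closed[OF subring])
    then show "f \<in> \<R>"
      using End_right_expansion[OF subringE(1)[OF centralizer_subring] co f] by simp
  qed
qed

end

text \<open>
  With \<open>e x\<close> written as the combination of the generators \<open>s\<close> with coefficients \<open>P x s\<close>, duality
  says that the matrix \<open>P\<close> is a left inverse of the matrix of values \<open>s y\<close>.
\<close>

lemma (in augmented_ring) dual_system_card_le:
  assumes ds: "dual_system A \<R> X e" and fin: "finite S" and S: "S \<subseteq> carrier (End_ring A)"
    and span: "\<R> \<subseteq> left_span (End_ring A) (left_mults A) S"
  shows "card X \<le> card S"
proof -
  have X: "finite X" "X \<subseteq> carrier A" and eR: "\<And>x. x \<in> X \<Longrightarrow> e x \<in> \<R>"
    and d: "\<And>x z. x \<in> X \<Longrightarrow> z \<in> X \<Longrightarrow> e x z = (if x = z then \<one>\<^bsub>A\<^esub> else \<zero>\<^bsub>A\<^esub>)"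
    using ds by (auto simp: dual_system_def)
  have row: "\<exists>P. P \<in> S \<rightarrow> carrier A \<and>
      (\<forall>y\<in>carrier A. e x y = (\<Oplus>\<^bsub>A\<^esub>s\<in>S. P s \<otimes>\<^bsub>A\<^esub> s y))" if x: "x \<in> X" for x
  proof -
    obtain c where c: "c \<in> S \<rightarrow> left_mults A"
      and ex: "e x = (\<Oplus>\<^bsub>End_ring A\<^esub>s\<in>S. c s \<otimes>\<^bsub>End_ring A\<^esub> s)"
      using span eR[OF x] by (auto simp: left_span_def)
    have "\<forall>s\<in>S. \<exists>a\<in>carrier A. c s = left_mult A a" using c by (auto simp: left_mults_def)
    then obtain P where P: "\<And>s. s \<in> S \<Longrightarrow> P s \<in> carrier A \<and> c s = left_mult A (P s)" by metis
    have t: "(\<lambda>s. c s \<otimes>\<^bsub>End_ring A\<^esub> s) \<in> S \<rightarrow> carrier (End_ring A)"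
      using P S R.left_mult_closed ring.ring_simprules(5)[OF R.End_ring_is_ring] by auto
    have "e x y = (\<Oplus>\<^bsub>A\<^esub>s\<in>S. P s \<otimes>\<^bsub>A\<^esub> s y)" if y: "y \<in> carrier A" for y
    proof -
      have "e x y = (\<Oplus>\<^bsub>A\<^esub>s\<in>S. (c s \<otimes>\<^bsub>End_ring A\<^esub> s) y)"
        unfolding ex by (rule R.End_ring_finsum_apply[OF t y])
      also have "\<dots> = (\<Oplus>\<^bsub>A\<^esub>s\<in>S. P s \<otimes>\<^bsub>A\<^esub> s y)"
        by (intro R.finsum_cong')
          (use P S y End_ringD(1)[OF subsetD[OF S] y] in \<open>auto simp: R.End_ring_apply\<close>)
      finally show ?thesis .
    qed
    with P show ?thesis by blast
  qed
  have "\<exists>P. \<forall>x\<in>X. P x \<in> S \<rightarrow> carrier A \<and>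
      (\<forall>y\<in>carrier A. e x y = (\<Oplus>\<^bsub>A\<^esub>s\<in>S. P x s \<otimes>\<^bsub>A\<^esub> s y))"
    by (rule bchoice, rule ballI, rule row)
  then obtain P where P: "\<forall>x\<in>X. P x \<in> S \<rightarrow> carrier A \<and>
      (\<forall>y\<in>carrier A. e x y = (\<Oplus>\<^bsub>A\<^esub>s\<in>S. P x s \<otimes>\<^bsub>A\<^esub> s y))"
    by (elim exE) (rule that)
  show ?thesis
  proof (rule card_le_of_matrix_left_inverse[OF fin X(1), of P "\<lambda>s y. s y"])
    show "P x s \<in> carrier A" if "x \<in> X" "s \<in> S" for x s
      using P that by blast
    show "s y \<in> carrier A" if "s \<in> S" "y \<in> X" for s y
      using End_ringD(1)[OF subsetD[OF S that(1)]] X that by auto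
    show "(\<Oplus>\<^bsub>A\<^esub>s\<in>S. P x s \<otimes>\<^bsub>A\<^esub> s y) = (if x = y then \<one>\<^bsub>A\<^esub> else \<zero>\<^bsub>A\<^esub>)" if "x \<in> X" "y \<in> X" for x y
    proof -
      have "y \<in> carrier A" using X that by auto
      then have "e x y = (\<Oplus>\<^bsub>A\<^esub>s\<in>S. P x s \<otimes>\<^bsub>A\<^esub> s y)" using P that by blast
      then show ?thesis using d that by simp
    qed
  qed
qed

section \<open>The correspondence\<close>

lemma (in ring) galois_subring_End_right:
  assumes "fin_division_subring R B"
  shows "galois_subring R (End_right R B)" and "End_left_elems R (End_right R B) = B"
proof -
  have B: "subring B R" and sk: "skew_field (R\<lparr>carrier := B\<rparr>)" and fd: "fin_dim_right R B"
    using assms by (auto simp: fin_division_subring_def)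
  interpret B: skew_field "R\<lparr>carrier := B\<rparr>" by (rule sk)
  have "Units (R\<lparr>carrier := B\<rparr>) = B - {\<zero>}" using B.skew_field_Units by simp
  then have div: "\<exists>b'\<in>B. b' \<otimes> b = \<one>" if "b \<in> B" "b \<noteq> \<zero>" for b
    using B.Units_one_closed that by (auto simp: Units_def)
  have one: "\<one> \<noteq> \<zero>" using B.Units_one_closed B.skew_field_Units by auto
  obtain X e where co: "right_coordinates R B X e"
    by (rule right_coordinates_if_fin_dim_right[OF B fd])
  note Bc = subringE(1)[OF B]
  show "galois_subring R (End_right R B)"
    unfolding galois_subring_def
    using subring_End_right[OF Bc] left_mults_subset_End_right[OF Bc]
      fin_gen_left_End_right[OF one Bc co] simple_End_right[OF one Bc co div] by blast
  show "End_left_elems R (End_right R B) = B"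
    by (rule End_left_elems_End_right[OF one B co div])
qed

lemma (in augmented_ring) fin_division_subring_End_left_elems:
  assumes g: "galois_subring A \<R>"
  shows "fin_division_subring A (End_left_elems A \<R>)" and "End_right A (End_left_elems A \<R>) = \<R>"
proof -
  interpret E: simple_endomorphism_subring A \<R>
    by (intro simple_endomorphism_subring.intro simple_endomorphism_subring_axioms.intro R.ring_axioms)
      (use g in \<open>simp_all add: galois_subring_def\<close>)
  obtain S where S: "finite S" "S \<subseteq> \<R>" "\<R> = left_span (End_ring A) (left_mults A) S"
    using g by (auto simp: galois_subring_def fin_gen_left_def)
  have bound: "card X \<le> card S" if "dual_system A \<R> X e" for X e
    using dual_system_card_le[OF that S(1)] S E.in_End by blast
  let ?P = "\<lambda>X. \<exists>e. dual_system A \<R> X e"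
  have "\<exists>X. ?P X \<and> (\<forall>X'. ?P X' \<longrightarrow> card X' \<le> card X)"
  proof (rule Lattices_Big.ex_has_greatest_nat)
    show "?P {}" by (simp add: dual_system_def)
    show "\<forall>X'. ?P X' \<longrightarrow> card X' < Suc (card S)"
      using bound by (intro allI impI le_imp_less_Suc) (elim exE)
  qed
  then obtain X where "?P X" and max: "\<And>X'. ?P X' \<Longrightarrow> card X' \<le> card X" by blast
  then obtain e where ds: "dual_system A \<R> X e" by blast
  have co: "right_coordinates A E.centralizer X e"
    by (rule E.right_coordinates_if_maximal[OF ds], rule max, rule exI)
  show "fin_division_subring A E.centralizer"
    unfolding fin_division_subring_def
    using E.centralizer_subring E.centralizer_skew_field
      R.fin_dim_right_if_right_coordinates[OF subringE(1)[OF E.centralizer_subring] co] by blast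
  show "End_right A E.centralizer = \<R>" by (rule E.End_right_centralizer[OF ds co])
qed

theorem theorem6p1:
  fixes A :: "('a, 'm) ring_scheme" and D :: "('d, 'n) ring_scheme" and h :: "'a \<Rightarrow> 'd"
  assumes "augmented_ring A D h"
  shows "bij_betw (End_right A) {B. fin_division_subring A B} {\<R>. galois_subring A \<R>}
    \<and> bij_betw (End_left_elems A) {\<R>. galois_subring A \<R>} {B. fin_division_subring A B}
    \<and> (\<forall>B. fin_division_subring A B \<longrightarrow> End_left_elems A (End_right A B) = B)
    \<and> (\<forall>\<R>. galois_subring A \<R> \<longrightarrow> End_right A (End_left_elems A \<R>) = \<R>)"
proof -
  interpret augmented_ring A D h by (rule assms)
  note facts = R.galois_subring_End_right fin_division_subring_End_left_elems
  have "bij_betw (End_right A) {B. fin_division_subring A B} {\<R>. galois_subring A \<R>}"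
    by (rule bij_betw_byWitness[where f' = "End_left_elems A"]) (use facts in auto)
  moreover have "bij_betw (End_left_elems A) {\<R>. galois_subring A \<R>} {B. fin_division_subring A B}"
    by (rule bij_betw_byWitness[where f' = "End_right A"]) (use facts in auto)
  ultimately show ?thesis using facts by blast
qed

end
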